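(* Let $q\ge2$ be a prime power, let $n\ge5$, and let $x$ be the unique positive real solution of $\log_q(x+1)=x-\binom{n}{\lfloor n/2\rfloor}$. Then $\operatorname{Trank}(\det^n_{\mathbb{F}_q})\ge\lceil x\rceil$. In particular, $\operatorname{Trank}(\det^n_{\mathbb{F}_q})\ge\binom{n}{\lfloor n/2\rfloor}+\log_q\binom{n}{\lfloor n/2\rfloor}$.
   Context: $\mathbb{F}_q$ is the field with $q$ elements. $\det^n_{\mathbb{F}_q}=\sum_{\sigma\in S_n}\operatorname{sgn}(\sigma)\mathbf{e}_{\sigma(1)}\otimes\cdots\otimes\mathbf{e}_{\sigma(n)}\in(\mathbb{F}_q^n)^{\otimes n}$, and $\operatorname{Trank}$ is tensor rank (least number of elementary tensors $\mathbf{v_1}\otimes\cdots\otimes\mathbf{v_n}$ summing to the tensor). *)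

theory Defs
  imports
    Complex_Main
    "HOL-Library.FuncSet"
    "HOL-Combinatorics.Permutations"
    "HOL-Number_Theory.Prime_Powers"
    "Jordan_Normal_Form.Matrix"
begin

text \<open>
  A tensor in \<open>(F\<^sup>n)\<close> to the tensor power \<open>d\<close> is represented by its coordinates with respect to
  the standard basis, a function on the multi-indices \<open>i\<close> with \<open>i k < n\<close> for \<open>k < d\<close>.
  Arguments that are not such multi-indices are mapped to \<open>0\<close>, so that equality of tensors is
  equality of functions. Tensor factors and basis vectors are numbered from \<open>0\<close>.
\<close>

type_synonym 'a tensor = "(nat \<Rightarrow> nat) \<Rightarrow> 'a"

definition multi_indices :: "nat \<Rightarrow> nat \<Rightarrow> (nat \<Rightarrow> nat) set" where
  "multi_indices d n = {..<d} \<rightarrow>\<^sub>E {..<n}"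

definition elementary_tensor :: "nat \<Rightarrow> nat \<Rightarrow> (nat \<Rightarrow> 'a::field vec) \<Rightarrow> 'a tensor" where
  "elementary_tensor d n v =
     (\<lambda>i. if i \<in> multi_indices d n then \<Prod>k<d. v k $ i k else 0)"

definition sum_of_elementary_tensors :: "nat \<Rightarrow> nat \<Rightarrow> nat \<Rightarrow> 'a::field tensor \<Rightarrow> bool" where
  "sum_of_elementary_tensors d n r T \<longleftrightarrow>
     (\<exists>v :: nat \<Rightarrow> nat \<Rightarrow> 'a vec.
        (\<forall>j<r. \<forall>k<d. v j k \<in> carrier_vec n) \<and>
        T = (\<lambda>i. \<Sum>j<r. elementary_tensor d n (v j) i))"

definition tensor_rank :: "nat \<Rightarrow> nat \<Rightarrow> 'a::field tensor \<Rightarrow> nat" where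
  "tensor_rank d n T = (LEAST r. sum_of_elementary_tensors d n r T)"

definition det_tensor :: "nat \<Rightarrow> 'a::field tensor" where
  "det_tensor n =
     (\<lambda>i. \<Sum>\<sigma> | \<sigma> permutes {..<n}.
        of_int (sign \<sigma>) * elementary_tensor n n (\<lambda>k. unit_vec n (\<sigma> k)) i)"

text \<open>
  The set over which the minimum in \<open>tensor_rank\<close> is taken is nonempty for the determinant tensor.
\<close>

lemma det_tensor_sum_of_elementary_tensors:
  assumes "0 < n"
  shows "\<exists>r. sum_of_elementary_tensors n n r (det_tensor n :: 'a::field tensor)"
proof -
  let ?P = "{\<sigma>. \<sigma> permutes {..<n}}"
  have "finite ?P"
    by (simp add: finite_permutations)
  then obtain h where h: "bij_betw h {..<card ?P} ?P"
    using ex_bij_betw_nat_finite[of ?P] by (auto simp: atLeast0LessThan)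
  define c :: "(nat \<Rightarrow> nat) \<Rightarrow> nat \<Rightarrow> 'a"
    where "c \<sigma> k = (if k = 0 then of_int (sign \<sigma>) else 1)" for \<sigma> k
  define w :: "(nat \<Rightarrow> nat) \<Rightarrow> nat \<Rightarrow> 'a vec"
    where "w \<sigma> k = c \<sigma> k \<cdot>\<^sub>v unit_vec n (\<sigma> k)" for \<sigma> k
  have c: "(\<Prod>k<n. c \<sigma> k) = of_int (sign \<sigma>)" for \<sigma>
    using assms by (simp add: c_def prod.delta)
  have w: "elementary_tensor n n (w \<sigma>) i =
      of_int (sign \<sigma>) * elementary_tensor n n (\<lambda>k. unit_vec n (\<sigma> k)) i" for \<sigma> i
  proof (cases "i \<in> multi_indices n n")
    case True
    then have "i k < n" if "k < n" for k
      using that by (auto simp: multi_indices_def PiE_def Pi_def)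
    then have "(\<Prod>k<n. w \<sigma> k $ i k) = (\<Prod>k<n. c \<sigma> k * unit_vec n (\<sigma> k) $ i k)"
      by (intro prod.cong) (auto simp: w_def)
    then show ?thesis
      using True by (simp add: elementary_tensor_def prod.distrib c)
  qed (simp add: elementary_tensor_def)
  have "det_tensor n = (\<lambda>i. \<Sum>j<card ?P. elementary_tensor n n (w (h j)) i)"
    unfolding det_tensor_def w[symmetric]
    by (rule ext, rule sum.reindex_bij_betw[OF h, symmetric])
  then have "sum_of_elementary_tensors n n (card ?P) (det_tensor n :: 'a tensor)"
    unfolding sum_of_elementary_tensors_def
    by (intro exI[of _ "\<lambda>j. w (h j)"]) (auto simp: w_def)
  then show ?thesis ..
qed

end

theory Submission imports Defs begin

text \<open>
  Let \<open>m = \<lfloor>n/2\<rfloor>\<close>, \<open>N\<close> the binomial coefficient \<open>n\<close> over \<open>m\<close>, and write the determinant tensor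
  as a sum of \<open>r\<close> elementary tensors. Contracting the first \<open>m\<close> factors with the functionals indexed
  by the \<open>m\<close>-element subsets of the basis maps a coefficient vector \<open>c\<close> of length \<open>N\<close> to the vector of
  the \<open>r\<close> scalars that the first \<open>m\<close> factors contribute. If \<open>c \<noteq> 0\<close>, the contraction is a nonzero
  alternating tensor of order \<open>n - m \<ge> 3\<close>, so it has rank at least 3 and at least three of these scalars
  are nonzero. They therefore form a linear code of length \<open>r\<close>, dimension \<open>N\<close> and minimum distance at
  least 3, and sphere packing gives \<open>q\<^sup>N (r + 1) \<le> q\<^sup>r\<close>. As \<open>x - log\<^sub>q (x + 1)\<close> is convex
  and vanishes at 0, this inequality forces \<open>r \<ge> x\<close> for the root \<open>x\<close>.
\<close>

section \<open>Coordinates of the determinant tensor\<close>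

lemma prod_unit_vec:
  assumes "\<And>k. k < n \<Longrightarrow> s k < n" and "\<And>k. k < n \<Longrightarrow> i k < n"
  shows "(\<Prod>k<n. unit_vec n (s k) $ i k) = (if \<forall>k<n. i k = s k then 1 else (0::'a::field))"
proof -
  have "(\<Prod>k<n. unit_vec n (s k) $ i k) = (\<Prod>k<n. if i k = s k then 1 else (0::'a))"
    using assms by (intro prod.cong) (auto simp: unit_vec_def)
  also have "\<dots> = (if \<forall>k<n. i k = s k then 1 else 0)"
    by (auto simp: prod_zero_iff)
  finally show ?thesis .
qed

lemma det_tensor_eq:
  assumes "i \<in> multi_indices n n"
  shows "det_tensor n i =
    (\<Sum>\<sigma> | \<sigma> permutes {..<n}. of_int (sign \<sigma>) * (if \<forall>k<n. i k = \<sigma> k then 1 else (0::'a::field)))"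
proof -
  have i: "i k < n" if "k < n" for k
    using assms that by (auto simp: multi_indices_def PiE_def Pi_def)
  have "elementary_tensor n n (\<lambda>k. unit_vec n (\<sigma> k)) i = (if \<forall>k<n. i k = \<sigma> k then 1 else (0::'a))"
    if "\<sigma> permutes {..<n}" for \<sigma>
    using assms i prod_unit_vec[of n \<sigma> i] permutes_in_image[OF that]
    by (simp add: elementary_tensor_def)
  then show ?thesis
    unfolding det_tensor_def by (intro sum.cong) auto
qed

lemma det_tensor_not_inj:
  assumes "i \<in> multi_indices n n" and "\<not> inj_on i {..<n}"
  shows "det_tensor n i = (0::'a::field)"
proof -
  have "\<not> (\<forall>k<n. i k = \<sigma> k)" if "\<sigma> permutes {..<n}" for \<sigma>
  proof
    assume "\<forall>k<n. i k = \<sigma> k"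
    then have "inj_on i {..<n} = inj_on \<sigma> {..<n}"
      by (intro inj_on_cong) auto
    then show False
      using assms(2) permutes_inj_on[OF that] by simp
  qed
  then have "of_int (sign \<sigma>) * (if \<forall>k<n. i k = \<sigma> k then 1 else 0) = (0::'a)"
    if "\<sigma> permutes {..<n}" for \<sigma>
    using that by (simp only: if_False mult_zero_right)
  then show ?thesis
    unfolding det_tensor_eq[OF assms(1)] by (intro sum.neutral) blast
qed

text \<open>Exactly one permutation matches an injective \<open>i\<close>, and its sign is nonzero
  in characteristic 2 as well.\<close>

lemma det_tensor_inj:
  assumes "i \<in> multi_indices n n" and "inj_on i {..<n}"
  shows "det_tensor n i \<noteq> (0::'a::field)"
proof -
  define \<tau> where "\<tau> k = (if k < n then i k else k)" for k
  have "i ` {..<n} \<subseteq> {..<n}"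
    using assms(1) by (auto simp: multi_indices_def)
  then have "bij_betw i {..<n} {..<n}"
    using assms(2) endo_inj_surj[of "{..<n}" i] by (auto simp: bij_betw_def)
  then have "bij_betw \<tau> {..<n} {..<n}"
    by (rule bij_betw_cong[THEN iffD1, rotated]) (simp add: \<tau>_def)
  then have \<tau>: "\<tau> permutes {..<n}"
    by (rule bij_imp_permutes) (simp add: \<tau>_def)
  have "(\<forall>k<n. i k = \<sigma> k) \<longleftrightarrow> \<sigma> = \<tau>" if "\<sigma> permutes {..<n}" for \<sigma>
    using permutes_not_in[OF that] by (auto simp: \<tau>_def fun_eq_iff)
  then have "det_tensor n i = (\<Sum>\<sigma> | \<sigma> permutes {..<n}. if \<sigma> = \<tau> then of_int (sign \<tau>) else (0::'a))"
    unfolding det_tensor_eq[OF assms(1)] by (intro sum.cong) simp_all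
  also have "\<dots> = of_int (sign \<tau>)"
    using \<tau> by (simp add: finite_permutations)
  finally show ?thesis
    by (simp add: sign_def)
qed

section \<open>Minimum distance of the contraction code\<close>

text \<open>The 3 by 3 matrix of these sums has rank at most 2, yet it would be diagonal with
  nonzero diagonal entries.\<close>

lemma sum_of_two_rank_one_not_diagonal:
  fixes x y :: "'b \<Rightarrow> nat \<Rightarrow> 'a::field"
  assumes "finite Z" and "card Z \<le> 2"
    and diag: "\<And>p. p < 3 \<Longrightarrow> (\<Sum>j\<in>Z. x j p * y j p) \<noteq> 0"
    and off: "\<And>p p'. p < 3 \<Longrightarrow> p' < 3 \<Longrightarrow> p \<noteq> p' \<Longrightarrow> (\<Sum>j\<in>Z. x j p * y j p') = 0"
  shows False
proof -
  obtain a b c d where M: "\<And>p p'. (\<Sum>j\<in>Z. x j p * y j p') = a p * b p' + c p * d p'"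
  proof -
    consider "card Z = 0" | "card Z = 1" | "card Z = 2"
      using assms(2) by linarith
    then show thesis
    proof cases
      case 1
      then show thesis
        using assms(1) that[of "\<lambda>_. 0" "\<lambda>_. 0" "\<lambda>_. 0" "\<lambda>_. 0"] by simp
    next
      case 2
      then obtain j where "Z = {j}"
        by (auto simp: card_1_singleton_iff)
      then show thesis
        using that[of "x j" "y j" "\<lambda>_. 0" "\<lambda>_. 0"] by simp
    next
      case 3
      then obtain j k where "Z = {j, k}" "j \<noteq> k"
        by (auto simp: card_2_iff)
      then show thesis
        using that[of "x j" "y j" "x k" "y k"] by simp
    qed
  qed
  have o: "a p * b p' + c p * d p' = 0" if "p < 3" "p' < 3" "p \<noteq> p'" for p p'
    using off[OF that] by (simp add: M)
  define A where "A p p' = a p * b p' + c p * d p'" for p p'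
  have z: "A 0 1 = 0" "A 0 2 = 0" "A 1 0 = 0" "A 1 2 = 0" "A 2 0 = 0" "A 2 1 = 0"
    using o by (simp_all add: A_def)
  \<comment> \<open>The 3 by 3 determinant; it vanishes identically for a sum of two rank-one
    matrices.\<close>
  have "A 0 0 * A 1 1 * A 2 2 + A 0 1 * A 1 2 * A 2 0 + A 0 2 * A 1 0 * A 2 1
      - A 0 2 * A 1 1 * A 2 0 - A 0 1 * A 1 0 * A 2 2 - A 0 0 * A 1 2 * A 2 1 = 0"
    by (simp add: A_def algebra_simps)
  then have "A 0 0 * A 1 1 * A 2 2 = 0"
    unfolding z by simp
  then show False
    using diag[of 0] diag[of 1] diag[of 2] by (simp add: M A_def)
qed

text \<open>The value \<open>undefined\<close> from \<open>n\<close> on is what the extensional set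
  \<open>multi_indices n n\<close> demands; \<open>g\<close> is read at its own positions
  \<open>m..<n\<close>, without a shift.\<close>

definition glue :: "nat \<Rightarrow> nat \<Rightarrow> (nat \<Rightarrow> nat) \<Rightarrow> (nat \<Rightarrow> nat) \<Rightarrow> nat \<Rightarrow> nat" where
  "glue m n f g k = (if k < m then f k else if k < n then g k else undefined)"

lemma glue_multi_index:
  assumes "m \<le> n" and "f ` {..<m} \<subseteq> {..<n}" and "g ` {m..<n} \<subseteq> {..<n}"
  shows "glue m n f g \<in> multi_indices n n"
  using assms by (auto simp: glue_def multi_indices_def PiE_def Pi_def extensional_def image_subset_iff)

lemma inj_on_glue_iff:
  assumes "m \<le> n"
  shows "inj_on (glue m n f g) {..<n} \<longleftrightarrow>
    inj_on f {..<m} \<and> inj_on g {m..<n} \<and> f ` {..<m} \<inter> g ` {m..<n} = {}"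
proof -
  have "inj_on (glue m n f g) {..<m} = inj_on f {..<m}"
    by (intro inj_on_cong) (auto simp: glue_def)
  moreover have "inj_on (glue m n f g) {m..<n} = inj_on g {m..<n}"
    by (intro inj_on_cong) (auto simp: glue_def)
  moreover have "glue m n f g ` {..<m} = f ` {..<m}"
    by (intro image_cong) (auto simp: glue_def)
  moreover have "glue m n f g ` {m..<n} = g ` {m..<n}"
    by (intro image_cong) (auto simp: glue_def)
  moreover have "{..<n} = {..<m} \<union> {m..<n}" "{..<m} - {m..<n} = {..<m}" "{m..<n} - {..<m} = {m..<n}"
    using assms by auto
  ultimately show ?thesis
    by (simp add: inj_on_Un)
qed

lemma prod_glue:
  assumes "m \<le> n"
  shows "(\<Prod>k<n. h k (glue m n f g k)) = (\<Prod>k<m. h k (f k)) * (\<Prod>k=m..<n. h k (g k) :: 'a::comm_monoid_mult)"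
proof -
  have "(\<Prod>k<n. h k (glue m n f g k)) =
      (\<Prod>k<m. h k (glue m n f g k)) * (\<Prod>k=m..<n. h k (glue m n f g k))"
    using assms prod.atLeastLessThan_concat[of 0 m n "\<lambda>k. h k (glue m n f g k)"]
    by (simp add: atLeast0LessThan)
  also have "(\<Prod>k<m. h k (glue m n f g k)) = (\<Prod>k<m. h k (f k))"
    by (simp add: glue_def)
  also have "(\<Prod>k=m..<n. h k (glue m n f g k)) = (\<Prod>k=m..<n. h k (g k))"
    by (simp add: glue_def)
  finally show ?thesis .
qed

text \<open>The functional with coefficients \<open>c\<close>, applied to the first \<open>m\<close>
  factors of the \<open>j\<close>-th summand; \<open>e S\<close> is meant to list \<open>S\<close>
  in some fixed order.\<close>

definition codeword ::
  "nat set set \<Rightarrow> nat \<Rightarrow> (nat set \<Rightarrow> nat \<Rightarrow> nat) \<Rightarrow> (nat \<Rightarrow> nat \<Rightarrow> 'a::field vec) \<Rightarrow> (nat set \<Rightarrow> 'a) \<Rightarrow> nat \<Rightarrow> 'a"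
  where "codeword \<S> m e v c j = (\<Sum>S\<in>\<S>. c S * (\<Prod>k<m. v j k $ e S k))"

lemma codeword_diff:
  "codeword \<S> m e v (\<lambda>S. c S - c' S) j = codeword \<S> m e v c j - codeword \<S> m e v c' j"
  by (simp add: codeword_def left_diff_distrib sum_subtractf)

text \<open>Contraction leaves the last \<open>n - m\<close> factors of each summand, weighted by
  the codeword. With at most two nonzero weights every flattening would have rank at most 2, but one
  of them contains a diagonal 3 by 3 block.\<close>

lemma codeword_weight:
  fixes v :: "nat \<Rightarrow> nat \<Rightarrow> 'a::field vec"
  assumes det: "det_tensor n = (\<lambda>i. \<Sum>j<r. elementary_tensor n n (v j) i)"
    and mn: "m + 3 \<le> n"
    and \<S>: "\<S> = {S. S \<subseteq> {..<n} \<and> card S = m}"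
    and e: "\<And>S. S \<in> \<S> \<Longrightarrow> bij_betw (e S) {..<m} S"
    and S0: "S0 \<in> \<S>" "c S0 \<noteq> 0"
  shows "card {j. j < r \<and> codeword \<S> m e v c j \<noteq> 0} \<ge> 3"
proof (rule ccontr)
  define w where "w = codeword \<S> m e v c"
  define Z where "Z = {j. j < r \<and> w j \<noteq> 0}"
  assume "\<not> ?thesis"
  then have Z: "finite Z" "card Z \<le> 2"
    by (auto simp: Z_def w_def)
  have fin: "finite \<S>"
    unfolding \<S> by (rule finite_subset[of _ "Pow {..<n}"]) auto
  have e_image: "e S ` {..<m} = S" and e_inj: "inj_on (e S) {..<m}"
    and S_sub: "S \<subseteq> {..<n}" and S_card: "card S = m" if "S \<in> \<S>" for S
    using e[OF that] that by (auto simp: bij_betw_def \<S>)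
  define T where "T g = (\<Sum>S\<in>\<S>. c S * det_tensor n (glue m n (e S) g))" for g
  have T_sum: "T g = (\<Sum>j\<in>Z. w j * (\<Prod>k=m..<n. v j k $ g k))" if "g ` {m..<n} \<subseteq> {..<n}" for g
  proof -
    have "det_tensor n (glue m n (e S) g) =
        (\<Sum>j<r. (\<Prod>k<m. v j k $ e S k) * (\<Prod>k=m..<n. v j k $ g k))" if "S \<in> \<S>" for S
    proof -
      have "glue m n (e S) g \<in> multi_indices n n"
        using mn e_image[OF that] S_sub[OF that] \<open>g ` {m..<n} \<subseteq> {..<n}\<close>
        by (intro glue_multi_index) auto
      then show ?thesis
        using mn prod_glue[of m n "\<lambda>k l. v _ k $ l" "e S" g] by (simp add: det elementary_tensor_def)
    qed
    then have "T g = (\<Sum>S\<in>\<S>. \<Sum>j<r. c S * ((\<Prod>k<m. v j k $ e S k) * (\<Prod>k=m..<n. v j k $ g k)))"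
      by (simp add: T_def sum_distrib_left)
    also have "\<dots> = (\<Sum>j<r. w j * (\<Prod>k=m..<n. v j k $ g k))"
      by (subst sum.swap) (simp add: w_def codeword_def sum_distrib_right mult.assoc)
    also have "\<dots> = (\<Sum>j\<in>Z. w j * (\<Prod>k=m..<n. v j k $ g k))"
      by (intro sum.mono_neutral_right) (auto simp: Z_def)
    finally show ?thesis .
  qed
  have D0: "det_tensor n (glue m n (e S) g) = (0::'a)"
    if "S \<in> \<S>" "g ` {m..<n} \<subseteq> {..<n}" "\<not> inj_on g {m..<n} \<or> S \<inter> g ` {m..<n} \<noteq> {}" for S g
    using that mn e_image[OF that(1)] S_sub[OF that(1)]
    by (intro det_tensor_not_inj glue_multi_index) (auto simp: inj_on_glue_iff)
  have T0: "T g = 0" if "g ` {m..<n} \<subseteq> {..<n}" "\<not> inj_on g {m..<n}" for g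
    using D0 that by (simp add: T_def)
  have T1: "T g \<noteq> 0" if g: "bij_betw g {m..<n} ({..<n} - S0)" for g
  proof -
    have g': "inj_on g {m..<n}" "g ` {m..<n} = {..<n} - S0"
      using g by (auto simp: bij_betw_def)
    \<comment> \<open>Any other \<open>m\<close>-subset meets the complement of \<open>S0\<close>,
      which \<open>g\<close> exhausts.\<close>
    have "det_tensor n (glue m n (e S) g) = (0::'a)" if "S \<in> \<S> - {S0}" for S
    proof (rule D0)
      have "\<not> S \<subseteq> S0"
        using that S0 S_card[of S] S_card[of S0] card_subset_eq[of S0 S] S_sub[of S0]
        by (auto dest: finite_subset)
      then show "\<not> inj_on g {m..<n} \<or> S \<inter> g ` {m..<n} \<noteq> {}"
        using that S_sub[of S] by (auto simp: g')
    qed (use that g' in auto)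
    then have "T g = c S0 * det_tensor n (glue m n (e S0) g)"
      using fin S0(1) by (simp add: T_def sum.remove[of _ S0])
    moreover have "det_tensor n (glue m n (e S0) g) \<noteq> (0::'a)"
      using mn e_image[OF S0(1)] S_sub[OF S0(1)] g' e_inj[OF S0(1)]
      by (intro det_tensor_inj glue_multi_index) (auto simp: inj_on_glue_iff)
    ultimately show ?thesis
      using S0(2) by simp
  qed
  have "card ({..<n} - S0) = n - m"
    using S_sub[OF S0(1)] S_card[OF S0(1)] by (simp add: card_Diff_subset finite_subset)
  then obtain g where g: "bij_betw g {m..<n} ({..<n} - S0)"
    using finite_same_card_bij[of "{m..<n}" "{..<n} - S0"] by auto
  \<comment> \<open>Putting \<open>g (m + p)\<close> in position \<open>m\<close> and the other values of \<open>g\<close> than \<open>g (m + p')\<close> in the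
     remaining positions gives a diagonal 3 by 3 submatrix of a flattening.\<close>
  define h where "h p p' k = (if k = m then g (m + p) else g (transpose m (m + p') k))" for p p' k
  have tr: "transpose m (m + p) ` {m..<n} = {m..<n}" if "p < 3" for p
    using that mn by (intro transpose_image_eq) auto
  have h_range: "h p p' ` {m..<n} \<subseteq> {..<n}" if "p < 3" "p' < 3" for p p'
  proof -
    have "g k < n" if "k \<in> {m..<n}" for k
      using g that by (auto simp: bij_betw_def)
    moreover have "transpose m (m + p') k \<in> {m..<n}" if "k \<in> {m..<n}" for k
      using tr[OF \<open>p' < 3\<close>] that by blast
    ultimately show ?thesis
      using that mn by (auto simp: h_def)
  qed
  \<comment> \<open>Flattening with factor \<open>m\<close> for the rows and the later factors for
    the columns; the weight goes into the rows.\<close>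
  define x where "x j p = w j * v j m $ g (m + p)" for j p
  define y where "y j p' = (\<Prod>k=Suc m..<n. v j k $ g (transpose m (m + p') k))" for j p'
  have T_h: "T (h p p') = (\<Sum>j\<in>Z. x j p * y j p')" if "p < 3" "p' < 3" for p p'
  proof -
    have "(\<Prod>k=m..<n. v j k $ h p p' k) = v j m $ g (m + p) * y j p'" for j
      using mn by (subst prod.atLeast_Suc_lessThan) (auto simp: y_def h_def intro!: prod.cong)
    then show ?thesis
      using T_sum[OF h_range[OF that]] by (simp add: x_def mult.assoc)
  qed
  show False
  proof (rule sum_of_two_rank_one_not_diagonal[OF Z, of x y])
    fix p :: nat assume p: "p < 3"
    \<comment> \<open>On the diagonal the omitted value is the one put at \<open>m\<close>, so
      \<open>h p p\<close> still enumerates the complement of \<open>S0\<close>.\<close>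
    have "h p p = g \<circ> transpose m (m + p)"
      by (auto simp: h_def fun_eq_iff)
    moreover have "bij_betw (transpose m (m + p)) {m..<n} {m..<n}"
      using tr[OF p] by (simp add: bij_betw_def)
    ultimately have "bij_betw (h p p) {m..<n} ({..<n} - S0)"
      using g bij_betw_trans by metis
    from T1[OF this] show "(\<Sum>j\<in>Z. x j p * y j p) \<noteq> 0"
      by (simp only: T_h[OF p p] not_False_eq_True)
  next
    fix p p' :: nat assume p: "p < 3" "p' < 3" "p \<noteq> p'"
    \<comment> \<open>The position other than \<open>m\<close> at which \<open>g (m + p)\<close>
      occurs a second time.\<close>
    define k where "k = transpose m (m + p') (m + p)"
    have "k \<in> {m..<n}"
      using p mn by (auto simp: k_def transpose_def)
    moreover have "k \<noteq> m"
      using p by (auto simp: k_def transpose_def)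
    moreover have "h p p' k = h p p' m"
      using \<open>k \<noteq> m\<close> by (simp add: h_def) (simp add: k_def)
    ultimately have "\<not> inj_on (h p p') {m..<n}"
      using mn inj_onD[of "h p p'" "{m..<n}" k m] by auto
    from T0[OF h_range[OF p(1,2)] this] show "(\<Sum>j\<in>Z. x j p * y j p') = 0"
      by (simp only: T_h[OF p(1,2)])
  qed
qed

section \<open>Sphere packing\<close>

text \<open>Adding 1 in at most one position gives \<open>r + 1\<close> words per codeword, and
  words from different codewords stay distinct because codewords differ in at least three positions.
  Other error values are left out, since the logarithmic equation only involves
  \<open>r + 1\<close>.\<close>

lemma sphere_packing_radius_one:
  fixes w :: "('s \<Rightarrow> 'a::{field,finite}) \<Rightarrow> nat \<Rightarrow> 'a"
  assumes "finite \<S>"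
    and diff: "\<And>c c' j. w (\<lambda>S. c S - c' S) j = w c j - w c' j"
    and weight: "\<And>c S. S \<in> \<S> \<Longrightarrow> c S \<noteq> 0 \<Longrightarrow> card {j. j < r \<and> w c j \<noteq> 0} \<ge> 3"
  shows "card (UNIV :: 'a set) ^ card \<S> * (r + 1) \<le> card (UNIV :: 'a set) ^ r"
proof -
  \<comment> \<open>The error position \<open>r\<close> stands for no error.\<close>
  define F where "F = (\<lambda>(c, s). \<lambda>j\<in>{..<r}. w c j + (if j = s then 1 else 0))"
  have "inj_on F ((\<S> \<rightarrow>\<^sub>E UNIV) \<times> {..r})"
  proof (rule inj_onI)
    fix u u' assume u: "u \<in> (\<S> \<rightarrow>\<^sub>E UNIV) \<times> {..r}" "u' \<in> (\<S> \<rightarrow>\<^sub>E UNIV) \<times> {..r}" "F u = F u'"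
    obtain c s c' s' where [simp]: "u = (c, s)" "u' = (c', s')"
      by (cases u, cases u')
    have eq: "w c j + (if j = s then 1 else 0) = w c' j + (if j = s' then 1 else 0)" if "j < r" for j
      using fun_cong[OF u(3), of j] that by (simp add: F_def)
    have "{j. j < r \<and> w (\<lambda>S. c S - c' S) j \<noteq> 0} \<subseteq> {s, s'}"
    proof
      fix j assume "j \<in> {j. j < r \<and> w (\<lambda>S. c S - c' S) j \<noteq> 0}"
      then show "j \<in> {s, s'}"
        using eq[of j] by (auto simp: diff split: if_splits)
    qed
    then have "card {j. j < r \<and> w (\<lambda>S. c S - c' S) j \<noteq> 0} \<le> card {s, s'}"
      by (intro card_mono) auto
    also have "\<dots> \<le> 2"
      by (simp add: card_insert_if)
    finally have "c S = c' S" if "S \<in> \<S>" for S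
      using weight[OF that, of "\<lambda>S. c S - c' S"] by force
    then have c: "c = c'"
      using u by (intro PiE_ext[of c \<S> "\<lambda>_. UNIV" c']) auto
    \<comment> \<open>If the error positions differ, one of them is below \<open>r\<close>, and
      there 1 would equal 0.\<close>
    have "s = s'"
    proof (rule ccontr)
      assume "s \<noteq> s'"
      then have "\<not> s < r" "\<not> s' < r"
        using eq[of s] eq[of s'] by (auto simp: c)
      then show False
        using \<open>s \<noteq> s'\<close> u by simp
    qed
    with c show "u = u'"
      by simp
  qed
  moreover have "F ` ((\<S> \<rightarrow>\<^sub>E UNIV) \<times> {..r}) \<subseteq> {..<r} \<rightarrow>\<^sub>E UNIV"
    by (auto simp: F_def intro!: restrict_PiE_iff[THEN iffD2])
  ultimately have "card ((\<S> \<rightarrow>\<^sub>E (UNIV :: 'a set)) \<times> {..r}) \<le> card ({..<r} \<rightarrow>\<^sub>E (UNIV :: 'a set))"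
    by (intro card_inj_on_le) (auto intro: finite_PiE)
  then show ?thesis
    using assms(1) by (simp add: card_cartesian_product card_PiE)
qed

lemma det_tensor_sphere_packing:
  assumes "n \<ge> 5" and "sum_of_elementary_tensors n n r (det_tensor n :: 'a::{field,finite} tensor)"
  shows "card (UNIV :: 'a set) ^ (n choose (n div 2)) * (r + 1) \<le> card (UNIV :: 'a set) ^ r"
proof -
  obtain v :: "nat \<Rightarrow> nat \<Rightarrow> 'a vec"
    where v: "det_tensor n = (\<lambda>i. \<Sum>j<r. elementary_tensor n n (v j) i)"
    using assms(2) by (auto simp: sum_of_elementary_tensors_def)
  define m where "m = n div 2"
  define \<S> where "\<S> = {S. S \<subseteq> {..<n} \<and> card S = m}"
  have "\<exists>f. bij_betw f {..<m} S" if "S \<in> \<S>" for S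
    using that finite_same_card_bij[of "{..<m}" S] by (auto simp: \<S>_def finite_subset)
  then obtain e where e: "\<And>S. S \<in> \<S> \<Longrightarrow> bij_betw (e S) {..<m} S"
    by metis
  \<comment> \<open>Here \<open>n \<ge> 5\<close> enters: at least three factors remain after the
    contraction.\<close>
  have "m + 3 \<le> n"
    using assms(1) by (auto simp: m_def)
  then have "card {j. j < r \<and> codeword \<S> m e v c j \<noteq> 0} \<ge> 3" if "S \<in> \<S>" "c S \<noteq> 0" for c S
    using codeword_weight[OF v _ \<S>_def e] that by blast
  moreover have "finite \<S>"
    unfolding \<S>_def by (rule finite_subset[of _ "Pow {..<n}"]) auto
  ultimately have "card (UNIV :: 'a set) ^ card \<S> * (r + 1) \<le> card (UNIV :: 'a set) ^ r"
    by (intro sphere_packing_radius_one[of _ "codeword \<S> m e v"] codeword_diff)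
  moreover have "card \<S> = n choose m"
    using n_subsets[of "{..<n}" m] by (simp add: \<S>_def)
  ultimately show ?thesis
    by (simp add: m_def)
qed

section \<open>The logarithmic equation\<close>

text \<open>Concavity of \<open>ln\<close> between 1 and \<open>x + 1\<close>, from the tangent
  bound ln u \<le> u - 1 at both endpoints divided by the intermediate point
  \<open>s\<close>.\<close>

lemma ln_concave_from_one:
  fixes t x :: real
  assumes "0 \<le> t" "t \<le> 1" "0 \<le> x"
  shows "t * ln (x + 1) \<le> ln (t * x + 1)"
proof -
  define s where "s = t * x + 1"
  have s: "s > 0"
    using assms by (simp add: s_def add_nonneg_pos)
  have "ln (1 / s) \<le> 1 / s - 1" "ln ((x + 1) / s) \<le> (x + 1) / s - 1"
    using s assms by (auto intro!: ln_le_minus_one)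
  then have "(1 - t) * ln (1 / s) + t * ln ((x + 1) / s) \<le> (1 - t) * (1 / s - 1) + t * ((x + 1) / s - 1)"
    using assms by (intro add_mono mult_left_mono) auto
  also have "\<dots> = 0"
    using s by (simp add: field_simps) (simp add: s_def algebra_simps)
  finally have "t * ln (x + 1) \<le> ln s"
    using s assms by (simp add: ln_div algebra_simps)
  then show ?thesis
    by (simp add: s_def)
qed

text \<open>The function \<open>y - log b (y + 1)\<close> is convex, 0 at 0 and \<open>N\<close> at
  the root \<open>x\<close>, so at \<open>y = t * x\<close> it is at most
  \<open>t * N < N\<close>.\<close>

lemma log_below_root:
  fixes b N x y :: real
  assumes "1 < b" "0 < N" "0 < y" "y < x" and x: "log b (x + 1) = x - N"
  shows "y - N < log b (y + 1)"
proof -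
  define t where "t = y / x"
  have t: "0 < t" "t < 1" "t * x = y"
    using assms by (auto simp: t_def)
  have "t * log b (x + 1) \<le> log b (y + 1)"
    using divide_right_mono[OF ln_concave_from_one[of t x], of "ln b"] t assms(1-4) by (simp add: log_def)
  moreover have "t * log b (x + 1) = y - t * N"
    using t by (simp add: x right_diff_distrib)
  moreover have "t * N < N"
    using t assms by simp
  ultimately show ?thesis
    by linarith
qed

text \<open>Intermediate values of \<open>x - log b (x + 1)\<close> between 0 and \<open>r\<close>:
  it is 0 at 0 and at least \<open>N\<close> at \<open>r\<close>.\<close>

lemma log_root_exists:
  fixes b N r :: real
  assumes "1 < b" "0 < N" "0 < r" "log b (r + 1) \<le> r - N"
  shows "\<exists>x>0. log b (x + 1) = x - N"
proof -
  have "\<exists>x\<ge>0. x \<le> r \<and> x - log b (x + 1) = N"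
    using assms by (intro IVT') (auto intro!: continuous_intros)
  then obtain x where x: "x \<ge> 0" "x - log b (x + 1) = N"
    by blast
  with assms have "x \<noteq> 0"
    by auto
  with x show ?thesis
    by (intro exI[of _ x]) auto
qed

theorem theorem6p2:
  fixes q n :: nat
  assumes "primepow q"
    and "card (UNIV :: 'a::{field,finite} set) = q"
    and "n \<ge> 5"
  shows "(\<exists>!x::real. x > 0 \<and> log (real q) (x + 1) = x - real (n choose (n div 2))) \<and>
    (\<forall>x::real. x > 0 \<and> log (real q) (x + 1) = x - real (n choose (n div 2)) \<longrightarrow>
       int (tensor_rank n n (det_tensor n :: 'a tensor)) \<ge> \<lceil>x\<rceil>) \<and>
    real (tensor_rank n n (det_tensor n :: 'a tensor)) \<ge>
       real (n choose (n div 2)) + log (real q) (real (n choose (n div 2)))"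
proof -
  define N where "N = n choose (n div 2)"
  define r where "r = tensor_rank n n (det_tensor n :: 'a tensor)"
  have q: "1 < real q"
    using primepow_gt_Suc_0[OF assms(1)] by simp
  have N: "0 < N"
    by (simp add: N_def)
  have "sum_of_elementary_tensors n n r (det_tensor n :: 'a tensor)"
    unfolding r_def tensor_rank_def
    by (rule LeastI_ex, rule det_tensor_sum_of_elementary_tensors) (use assms(3) in simp)
  then have pack: "q ^ N * (r + 1) \<le> q ^ r"
    using det_tensor_sphere_packing[OF assms(3), where 'a = 'a, unfolded assms(2)] by (simp add: N_def)
  have "log q (real (q ^ N * (r + 1))) \<le> log q (real (q ^ r))"
    using q pack by (subst log_le_cancel_iff) (auto simp del: of_nat_mult of_nat_power mult_Suc_right)
  then have bound: "log q (real r + 1) \<le> real r - real N"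
    using q by (simp add: log_mult log_nat_power add.commute del: mult_Suc_right flip: of_nat_Suc)
  have "0 \<le> log q (real r + 1)"
    using q by simp
  with bound have rN: "real N \<le> real r"
    by linarith
  with N have r: "0 < real r"
    by linarith
  \<comment> \<open>No positive point below a root satisfies the packing inequality: with another
    root as \<open>y\<close> this gives uniqueness, with \<open>y = r\<close> the lower bound on the
    rank.\<close>
  have below: False if "0 < y" "y < x" "log q (x + 1) = x - real N" "log q (y + 1) \<le> y - real N" for x y
    using log_below_root[OF q _ that(1-3)] N that(4) by simp
  obtain x0 where x0: "x0 > 0" "log q (x0 + 1) = x0 - real N"
    using log_root_exists[OF q _ r bound] N by auto
  have "\<exists>!x. x > 0 \<and> log q (x + 1) = x - real N"
    using x0 below by (intro ex1I[of _ x0]) (auto, metis linorder_neqE_linordered_idom order_refl)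
  moreover have "\<lceil>x\<rceil> \<le> int r" if "x > 0" "log q (x + 1) = x - real N" for x
    using below[OF r _ that(2) bound] by (force simp: ceiling_le_iff)
  \<comment> \<open>The explicit bound bypasses the root: \<open>r \<ge> N\<close> is fed back into
    the packing inequality.\<close>
  moreover have "real N + log q (real N) \<le> real r"
  proof -
    have "log q (real N) \<le> log q (real r + 1)"
      using q N rN by (subst log_le_cancel_iff) auto
    with bound show ?thesis
      by linarith
  qed
  ultimately show ?thesis
    by (simp add: N_def r_def)
qed

end
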